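(* The Helly number of a semilattice (with respect to its algebraic convexity, whose convex sets are the subsemilattices) equals its depth.
   Context: A semilattice is a poset $S$ in which every nonempty finite subset has a supremum; write $x\oplus y$ for the supremum of $\{x,y\}$. The convex subsets of $S$ are its subsemilattices, i.e. the subsets closed under $\oplus$ (including the empty set). The depth of $S$ is the supremum of the cardinalities of chains (linearly ordered subsets) of $S$, taken in $\mathbb{N}\cup\{\infty\}$. The Helly number of $S$ is the least integer $h$ such that each finite family of convex subsets of $S$ meeting $h$ by $h$ has a nonempty intersection; it is $\infty$ if no such integer exists. A family meets $h$ by $h$ if every subfamily with at most $h$ members has a nonempty intersection (the intersection of the empty family being $S$). *)

theory Defs
  imports "HOL-Algebra.Lattice" "HOL-Library.Extended_Nat"
begin

text \<open>Suprema of pairs, as required by \<^locale>\<open>upper_semilattice\<close>, give suprema of all nonempty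
  finite subsets. The carrier may be empty.\<close>

lemma upper_semilattice_iff:
  "upper_semilattice L \<longleftrightarrow> partial_order L \<and>
     (\<forall>A. finite A \<and> A \<noteq> {} \<and> A \<subseteq> carrier L \<longrightarrow> (\<exists>s. least L s (Upper L A)))"
proof
  assume "upper_semilattice L"
  then interpret upper_semilattice L .
  show "partial_order L \<and>
      (\<forall>A. finite A \<and> A \<noteq> {} \<and> A \<subseteq> carrier L \<longrightarrow> (\<exists>s. least L s (Upper L A)))"
    using finite_sup_least partial_order_axioms by blast
next
  assume "partial_order L \<and>
      (\<forall>A. finite A \<and> A \<noteq> {} \<and> A \<subseteq> carrier L \<longrightarrow> (\<exists>s. least L s (Upper L A)))"
  then show "upper_semilattice L"
    by (simp add: upper_semilattice_def upper_semilattice_axioms_def)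
qed

definition subsemilattices :: "('a, 'b) gorder_scheme \<Rightarrow> 'a set set"
  where "subsemilattices L =
    {C. C \<subseteq> carrier L \<and> (\<forall>x\<in>C. \<forall>y\<in>C. x \<squnion>\<^bsub>L\<^esub> y \<in> C)}"

definition ecard :: "'a set \<Rightarrow> enat"
  where "ecard A = (if finite A then enat (card A) else \<infinity>)"

definition depth :: "('a, 'b) gorder_scheme \<Rightarrow> enat"
  where "depth L =
    (SUP C \<in> {C. C \<subseteq> carrier L \<and> Complete_Partial_Order.chain (le L) C}. ecard C)"

text \<open>Intersections are taken inside the ambient set \<open>X\<close>, so that the empty family has
  intersection \<open>X\<close> rather than the whole type. Since repeating a member affects neither the
  intersection of a finite family nor whether it meets \<open>h\<close> by \<open>h\<close>, families are rendered as
  sets of sets.\<close>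

definition meets_by :: "'a set \<Rightarrow> nat \<Rightarrow> 'a set set \<Rightarrow> bool"
  where "meets_by X h F \<longleftrightarrow> (\<forall>G. G \<subseteq> F \<and> finite G \<and> card G \<le> h \<longrightarrow> X \<inter> \<Inter>G \<noteq> {})"

definition has_helly :: "'a set \<Rightarrow> 'a set set \<Rightarrow> nat \<Rightarrow> bool"
  where "has_helly X \<C> h \<longleftrightarrow>
    (\<forall>F. finite F \<and> F \<subseteq> \<C> \<and> meets_by X h F \<longrightarrow> X \<inter> \<Inter>F \<noteq> {})"

text \<open>The Helly number of the set \<open>X\<close> with respect to the collection \<open>\<C>\<close> of its convex subsets.\<close>

definition helly_number :: "'a set \<Rightarrow> 'a set set \<Rightarrow> enat"
  where "helly_number X \<C> =
    (if \<exists>h. has_helly X \<C> h then enat (LEAST h. has_helly X \<C> h) else \<infinity>)"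

end

theory Submission
  imports Defs
begin

text \<open>A nonempty finite chain \<open>C\<close> of \<open>n\<close> elements witnesses that the Helly number is at least \<open>n\<close>: every
  subset of a chain is a subsemilattice, and the \<open>n\<close> sets \<open>C - {c}\<close> have empty intersection
  although any fewer of them share a point.

  Conversely, suppose that every chain has at most \<open>h\<close> elements and that a finite family \<open>F\<close> meets
  \<open>h\<close> by \<open>h\<close>. By induction on the size of \<open>F\<close> it may be assumed that \<open>F\<close> has more than \<open>h\<close>
  members and that for each \<open>D\<close> in \<open>F\<close> some point \<open>x D\<close> lies in all the other members. The idea is
  to delete members from \<open>F\<close> one at a time and to watch the supremum of the remaining points.
  If each deletion could be chosen so as to make the supremum strictly smaller, then the suprema
  would form a chain with as many elements as \<open>F\<close> has members, which is too long. Hence there is a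
  nonempty \<open>Y \<subseteq> F\<close> such that deleting any one of its members leaves at least one other and does
  not change the supremum of \<open>x ` Y\<close>
  (\<open>indispensable_points_give_chain\<close>), and this supremum lies in all members of \<open>F\<close>: a member
  \<open>D\<close> outside \<open>Y\<close> contains all the points \<open>x E\<close> with \<open>E \<in> Y\<close>, and for \<open>D\<close> in \<open>Y\<close> the
  supremum is already that of the points \<open>x E\<close> with \<open>E \<noteq> D\<close>, which belong to \<open>D\<close>.

  So the Helly property holds for \<open>h\<close> exactly if \<open>h\<close> bounds the depth; both numbers are the least such
  \<open>h\<close>, or \<open>\<infinity>\<close> if there is none.\<close>

lemma helly_number_eqI:
  assumes "\<And>h. has_helly X \<C> h \<longleftrightarrow> d \<le> enat h"
  shows "helly_number X \<C> = d"
proof (cases d)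
  case (enat n)
  have "(LEAST h. n \<le> h) = n"
    by (rule Least_equality) auto
  then show ?thesis
    using enat by (auto simp: helly_number_def assms)
next
  case infinity
  then show ?thesis
    by (simp add: helly_number_def assms)
qed

lemma depth_le_iff:
  "depth L \<le> enat h \<longleftrightarrow>
     (\<forall>C. C \<subseteq> carrier L \<and> finite C \<and> Complete_Partial_Order.chain (le L) C \<longrightarrow> card C \<le> h)"
  (is "?lhs \<longleftrightarrow> ?rhs")
proof
  assume bound: ?lhs
  show ?rhs
  proof (intro allI impI)
    fix C
    assume C: "C \<subseteq> carrier L \<and> finite C \<and> Complete_Partial_Order.chain (le L) C"
    then have "ecard C \<le> depth L"
      unfolding depth_def by (intro SUP_upper) auto
    with bound have "ecard C \<le> enat h"
      by (rule order_trans[rotated])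
    with C show "card C \<le> h"
      by (simp add: ecard_def)
  qed
next
  assume bound: ?rhs
  have "ecard C \<le> enat h"
    if C: "C \<subseteq> carrier L" "Complete_Partial_Order.chain (le L) C" for C
  proof (cases "finite C")
    case True
    then show ?thesis
      using bound C by (simp add: ecard_def)
  next
    case False
    then obtain B where B: "finite B" "card B = Suc h" "B \<subseteq> C"
      using infinite_arbitrarily_large by blast
    then have "card B \<le> h"
      using bound C(1) chain_subset[OF C(2) B(3)] by (meson order_trans)
    with B show ?thesis
      by simp
  qed
  then show ?lhs
    by (auto simp: depth_def SUP_le_iff)
qed

context upper_semilattice
begin

lemma finite_sup_mono:
  assumes "finite B" "B \<subseteq> carrier L" "A \<subseteq> B" "A \<noteq> {}"
  shows "\<Squnion>A \<sqsubseteq> \<Squnion>B"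
proof -
  have A: "least L (\<Squnion>A) (Upper L A)"
    using assms by (intro finite_sup_least) (auto intro: finite_subset)
  have B: "least L (\<Squnion>B) (Upper L B)"
    using assms by (intro finite_sup_least) auto
  have "\<Squnion>B \<in> Upper L A"
    by (rule subsetD[OF Upper_antimono[OF assms(3)] least_mem[OF B]])
  with A show ?thesis
    by (rule least_le)
qed

lemma join_eq_right:
  assumes "x \<in> carrier L" "y \<in> carrier L" "x \<sqsubseteq> y"
  shows "x \<squnion> y = y"
  by (rule le_antisym) (use assms in \<open>auto intro: join_le join_right\<close>)

lemma subset_of_chain_is_subsemilattice:
  assumes "C \<subseteq> carrier L" "Complete_Partial_Order.chain (le L) C" "B \<subseteq> C"
  shows "B \<in> subsemilattices L"
proof -
  have "x \<squnion> y \<in> B" if "x \<in> B" "y \<in> B" for x y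
  proof -
    have carr: "x \<in> carrier L" "y \<in> carrier L"
      using that assms by auto
    have "x \<sqsubseteq> y \<or> y \<sqsubseteq> x"
      using that assms unfolding Complete_Partial_Order.chain_def by blast
    then have "x \<squnion> y = y \<or> x \<squnion> y = x"
      using carr join_eq_right join_comm by metis
    with that show ?thesis
      by auto
  qed
  with assms show ?thesis
    by (auto simp: subsemilattices_def)
qed

lemma finite_sup_in_subsemilattice:
  assumes "finite A" "A \<noteq> {}" "A \<subseteq> D" "D \<in> subsemilattices L"
  shows "\<Squnion>A \<in> D"
  using assms(1-3)
proof (induction rule: finite_ne_induct)
  case (singleton a)
  moreover have "a \<in> carrier L"
    using singleton assms(4) by (auto simp: subsemilattices_def)
  ultimately show ?case
    using weak_sup_of_singleton[of a] unfolding eq_is_equal by simp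
next
  case (insert a A)
  have carr: "a \<in> carrier L" "A \<subseteq> carrier L"
    using insert.prems assms(4) by (auto simp: subsemilattices_def)
  have s: "\<Squnion>A \<in> carrier L" "\<Squnion>(insert a A) \<in> carrier L"
    using insert.hyps carr by auto
  have above: "x \<sqsubseteq> \<Squnion>B" if "x \<in> B" "finite B" "B \<subseteq> carrier L" for x B
    using least_Upper_above[OF finite_sup_least[OF that(2,3)] that(1,3)] that(1) by blast
  have "\<Squnion>(insert a A) = a \<squnion> \<Squnion>A"
  proof (rule le_antisym)
    show "a \<squnion> \<Squnion>A \<sqsubseteq> \<Squnion>(insert a A)"
    proof (rule join_le)
      show "a \<sqsubseteq> \<Squnion>(insert a A)"
        using insert.hyps(1) carr by (intro above) auto
      show "\<Squnion>A \<sqsubseteq> \<Squnion>(insert a A)"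
        using insert.hyps carr by (intro finite_sup_mono) auto
    qed (use carr s in auto)
    have "y \<sqsubseteq> a \<squnion> \<Squnion>A" if "y \<in> insert a A" for y
    proof (cases "y = a")
      case True
      then show ?thesis
        using carr s by (auto intro: join_left)
    next
      case False
      with that have "y \<in> A" by simp
      then have "y \<sqsubseteq> \<Squnion>A"
        using above insert.hyps carr by blast
      then show ?thesis
        using \<open>y \<in> A\<close> carr s by (meson join_closed join_right le_trans subsetD)
    qed
    then have "a \<squnion> \<Squnion>A \<in> Upper L (insert a A)"
      using carr s by (intro Upper_memI) auto
    then show "\<Squnion>(insert a A) \<sqsubseteq> a \<squnion> \<Squnion>A"
      using finite_sup_least[of "insert a A"] insert.hyps carr by (auto intro: least_le)
  qed (use carr s in auto)
  moreover have "a \<squnion> \<Squnion>A \<in> D"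
    using insert assms(4) by (auto simp: subsemilattices_def)
  ultimately show ?case
    by (simp only:)
qed

text \<open>The sets obtained from a chain by deleting one element have no common point, but fewer
  than all of them share the element deleted by a missing one.\<close>

lemma card_chain_le_if_has_helly:
  assumes helly: "has_helly (carrier L) (subsemilattices L) h"
    and C: "C \<subseteq> carrier L" "finite C" "Complete_Partial_Order.chain (le L) C"
  shows "card C \<le> h"
proof (rule ccontr)
  assume "\<not> card C \<le> h"
  then have long: "h < card C"
    by simp
  then have "C \<noteq> {}"
    by auto
  define F where "F = (\<lambda>c. C - {c}) ` C"
  have "carrier L \<inter> \<Inter>G \<noteq> {}" if G: "G \<subseteq> F" "finite G" "card G \<le> h" for G
  proof -
    \<comment> \<open>Distinct elements must give distinct sets, so that \<open>G\<close> is too small to contain them all.\<close>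
    have inj: "inj_on (\<lambda>c. C - {c}) C"
      by (rule inj_onI) blast
    have "card G < card F"
      using G long card_image[OF inj] by (simp add: F_def)
    then have "\<not> F \<subseteq> G"
      using card_mono[OF G(2)] by (meson not_less)
    then obtain c where "c \<in> C" "C - {c} \<notin> G"
      by (auto simp: F_def)
    then have "c \<in> carrier L \<inter> \<Inter>G"
      using G(1) C(1) by (auto simp: F_def)
    then show ?thesis
      by blast
  qed
  moreover have "F \<subseteq> subsemilattices L"
    using subset_of_chain_is_subsemilattice[OF C(1,3)] by (auto simp: F_def)
  moreover have "finite F"
    using C(2) by (simp add: F_def)
  ultimately have "carrier L \<inter> \<Inter>F \<noteq> {}"
    using helly by (auto simp: has_helly_def meets_by_def)
  with \<open>C \<noteq> {}\<close> show False
    by (auto simp: F_def)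
qed

text \<open>Deleting indispensable points one after another lowers the supremum strictly each time, so
  the successive suprema form a chain. Keeping this chain below the current supremum allows the
  induction to add the next larger supremum on top.\<close>

lemma indispensable_points_give_chain:
  assumes "finite I" "I \<noteq> {}" "x ` I \<subseteq> carrier L"
    and "\<And>J. J \<subseteq> I \<Longrightarrow> J \<noteq> {} \<Longrightarrow> \<exists>i\<in>J. J = {i} \<or> \<Squnion>(x ` (J - {i})) \<noteq> \<Squnion>(x ` J)"
  shows "\<exists>C \<subseteq> carrier L. finite C \<and> Complete_Partial_Order.chain (le L) C
    \<and> card C = card I \<and> (\<forall>c\<in>C. c \<sqsubseteq> \<Squnion>(x ` I))"
  using assms
proof (induction "card I" arbitrary: I)
  case 0
  then show ?case
    by simp
next
  case (Suc n)
  obtain i where i: "i \<in> I" "I = {i} \<or> \<Squnion>(x ` (I - {i})) \<noteq> \<Squnion>(x ` I)"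
    using Suc.prems(2) Suc.prems(4)[of I] by auto
  have top: "\<Squnion>(x ` I) \<in> carrier L"
    using Suc.prems by (intro finite_sup_closed) auto
  show ?case
  proof (cases "I = {i}")
    case True
    show ?thesis
      by (rule exI[of _ "{\<Squnion>(x ` I)}"])
        (use top True in \<open>auto simp: Complete_Partial_Order.chain_def\<close>)
  next
    case False
    define s where "s = \<Squnion>(x ` (I - {i}))"
    have ne: "I - {i} \<noteq> {}"
      using False i by auto
    have "\<exists>C \<subseteq> carrier L. finite C \<and> Complete_Partial_Order.chain (le L) C
        \<and> card C = card (I - {i}) \<and> (\<forall>c\<in>C. c \<sqsubseteq> \<Squnion>(x ` (I - {i})))"
    proof (rule Suc.hyps(1))
      show "n = card (I - {i})"
        using Suc.hyps(2) Suc.prems(1) i by simp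
      show "\<exists>j\<in>J. J = {j} \<or> \<Squnion>(x ` (J - {j})) \<noteq> \<Squnion>(x ` J)"
        if "J \<subseteq> I - {i}" "J \<noteq> {}" for J
        using that by (intro Suc.prems(4)) auto
    qed (use Suc.prems ne in auto)
    then obtain C where C: "C \<subseteq> carrier L" "finite C" "Complete_Partial_Order.chain (le L) C"
        "card C = card (I - {i})" and below: "\<And>c. c \<in> C \<Longrightarrow> c \<sqsubseteq> s"
      unfolding s_def by blast
    have s: "s \<in> carrier L"
      using Suc.prems ne unfolding s_def by (intro finite_sup_closed) auto
    have le: "s \<sqsubseteq> \<Squnion>(x ` I)"
      using Suc.prems ne unfolding s_def by (intro finite_sup_mono) auto
    have "s \<noteq> \<Squnion>(x ` I)"
      using i False by (auto simp: s_def)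
    then have new: "\<Squnion>(x ` I) \<notin> C"
      using below le le_antisym s top by blast
    have below_top: "c \<sqsubseteq> \<Squnion>(x ` I)" if "c \<in> insert (\<Squnion>(x ` I)) C" for c
    proof (cases "c = \<Squnion>(x ` I)")
      case True
      with top show ?thesis
        by simp
    next
      case False
      with that have "c \<in> C"
        by simp
      then show ?thesis
        using le_trans[OF below le _ s top] C(1) by blast
    qed
    show ?thesis
    proof (intro exI[of _ "insert (\<Squnion>(x ` I)) C"] conjI)
      show "Complete_Partial_Order.chain (le L) (insert (\<Squnion>(x ` I)) C)"
        using C(3) below_top by (auto simp: Complete_Partial_Order.chain_def)
      show "card (insert (\<Squnion>(x ` I)) C) = card I"
        using C(2,4) new Suc.prems(1) i Suc.hyps(2) by simp
    qed (use C top below_top in auto)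
  qed
qed

lemma has_helly_if_card_chain_le:
  assumes short: "\<And>C. C \<subseteq> carrier L \<Longrightarrow> finite C \<Longrightarrow> Complete_Partial_Order.chain (le L) C
      \<Longrightarrow> card C \<le> h"
  shows "has_helly (carrier L) (subsemilattices L) h"
proof -
  have "carrier L \<inter> \<Inter>F \<noteq> {}"
    if "finite F" "F \<subseteq> subsemilattices L" "meets_by (carrier L) h F" for F
    using that
  proof (induction "card F" arbitrary: F)
    case 0
    then show ?case
      by (auto simp: meets_by_def)
  next
    case (Suc n)
    show ?case
    proof (cases "card F \<le> h")
      case True
      with Suc.prems show ?thesis
        by (simp add: meets_by_def)
    next
      case False
      have "carrier L \<inter> \<Inter>(F - {D}) \<noteq> {}" if "D \<in> F" for D
      proof (rule Suc.hyps(1))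
        show "n = card (F - {D})"
          using Suc.hyps(2) Suc.prems(1) that by simp
        show "meets_by (carrier L) h (F - {D})"
          using Suc.prems(3) unfolding meets_by_def by blast
      qed (use Suc.prems in auto)
      then have "\<forall>D\<in>F. \<exists>p. p \<in> carrier L \<inter> \<Inter>(F - {D})"
        by blast
      then obtain x where x: "\<And>D. D \<in> F \<Longrightarrow> x D \<in> carrier L \<inter> \<Inter>(F - {D})"
        by metis
      have "F \<noteq> {}"
        using Suc.hyps(2) by auto
      have carr: "x ` F \<subseteq> carrier L"
        using x by auto
      have "\<not> (\<forall>Y. Y \<subseteq> F \<longrightarrow> Y \<noteq> {} \<longrightarrow>
          (\<exists>D\<in>Y. Y = {D} \<or> \<Squnion>(x ` (Y - {D})) \<noteq> \<Squnion>(x ` Y)))"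
        using indispensable_points_give_chain[OF Suc.prems(1) \<open>F \<noteq> {}\<close> carr] short False by metis
      then obtain Y where Y: "Y \<subseteq> F" "Y \<noteq> {}"
        and dispensable: "\<And>D. D \<in> Y \<Longrightarrow> Y \<noteq> {D} \<and> \<Squnion>(x ` (Y - {D})) = \<Squnion>(x ` Y)"
        by blast
      have "finite Y"
        using Y Suc.prems(1) finite_subset by blast
      \<comment> \<open>For \<open>D\<close> outside \<open>Y\<close> nothing is removed below, so one argument covers all members.\<close>
      have "\<Squnion>(x ` Y) \<in> D" if "D \<in> F" for D
      proof -
        have "\<Squnion>(x ` (Y - {D})) \<in> D"
        proof (rule finite_sup_in_subsemilattice)
          show "x ` (Y - {D}) \<noteq> {}"
            using Y dispensable by blast
          show "x ` (Y - {D}) \<subseteq> D"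
            using x Y(1) that by blast
        qed (use \<open>finite Y\<close> Suc.prems(2) that in auto)
        moreover have "\<Squnion>(x ` (Y - {D})) = \<Squnion>(x ` Y)"
          using dispensable by (cases "D \<in> Y") auto
        ultimately show ?thesis
          by simp
      qed
      moreover have "\<Squnion>(x ` Y) \<in> carrier L"
        using \<open>finite Y\<close> Y carr by (intro finite_sup_closed) auto
      ultimately show ?thesis
        by blast
    qed
  qed
  then show ?thesis
    by (auto simp: has_helly_def)
qed

end

theorem proposition6p6:
  fixes L :: "('a, 'b) gorder_scheme"
  assumes "upper_semilattice L"
  shows "helly_number (carrier L) (subsemilattices L) = depth L"
proof (rule helly_number_eqI)
  interpret upper_semilattice L
    by (rule assms)
  show "has_helly (carrier L) (subsemilattices L) h \<longleftrightarrow> depth L \<le> enat h" for h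
    using card_chain_le_if_has_helly has_helly_if_card_chain_le unfolding depth_le_iff by metis
qed

end
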